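(* Assume that the real number $\alpha$ is of type $t>1$. Then there is a constant $C$ such that for all $N$ large enough $$\prod_{n=1}^N|2\sin(\pi n\alpha)|\le 2^{CN^{1-1/t}}.$$
   Context: A real number $\alpha$ is said to be of type $t\ge1$ if there is a constant $c>0$ such that $\left|\alpha-\frac pq\right|>c\,\frac{1}{q^{1+t}}$ for all integers $p$ and $q\ge 1$ with $\gcd(p,q)=1$. *)

theory Defs
  imports Complex_Main
begin

definition of_type :: "real \<Rightarrow> real \<Rightarrow> bool" where
  "of_type \<alpha> t \<longleftrightarrow> t \<ge> 1 \<and>
     (\<exists>c>0. \<forall>p q :: int. q \<ge> 1 \<longrightarrow> gcd p q = 1 \<longrightarrow>
        \<bar>\<alpha> - real_of_int p / real_of_int q\<bar> > c * (1 / real_of_int q powr (1 + t)))"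

end

theory Submission imports Defs "HOL-Analysis.Analysis" begin

text \<open>
  The product is bounded uniformly in a shift \<open>x\<close> of the argument, by strong induction on \<open>N\<close>.
  Dirichlet's theorem gives a reduced fraction \<open>p / q\<close> with \<open>q \<le> N\<close> and \<open>\<bar>q \<alpha> - p\<bar> < 1 / N\<close>;
  the type condition forces \<open>q\<close> to be at least of order \<open>N powr (1 / t)\<close>. Write \<open>N = M q + r\<close> with
  \<open>r < q\<close>. On each of the \<open>M\<close> blocks of length \<open>q\<close> the points \<open>n \<alpha>\<close> are within \<open>1 / N\<close> of the
  points \<open>n p / q\<close>, whose product is at most \<open>2\<close> because it is \<open>\<bar>z ^ q - 1\<bar>\<close> for some \<open>z\<close> on the
  unit circle. The perturbation costs a bounded factor (from the point nearest to a zero of the sine)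
  and a factor \<open>exp (O (q / N * ln N))\<close> (from the others). As \<open>M \<le> N / q\<close>, all blocks together
  contribute \<open>exp (O (N powr (1 - 1 / t)) + O (ln N))\<close>. Since \<open>r \<le> N / 2\<close>, the contributions of the
  successive remainders form a geometric series.
\<close>

section \<open>Elementary estimates for the sine and harmonic numbers\<close>

text \<open>By concavity, the sine lies above its chord between 0 and \<open>pi / 2\<close>.\<close>

lemma sin_ge_jordan:
  fixes x :: real
  assumes "0 \<le> x" "x \<le> pi / 2"
  shows "2 / pi * x \<le> sin x"
proof -
  have "concave_on {0..pi/2} (sin :: real \<Rightarrow> real)"
    by (rule f''_le0_imp_concave[where f' = cos and f'' = "\<lambda>x. - sin x"])
       (auto intro!: derivative_eq_intros sin_ge_zero)
  then have "sin ((1 - 2 * x / pi) *\<^sub>R 0 + (2 * x / pi) *\<^sub>R (pi / 2)) \<ge>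
      (1 - 2 * x / pi) * sin 0 + (2 * x / pi) * sin (pi / 2)"
    using assms by (intro concave_onD) (auto simp: field_simps)
  then show ?thesis by (simp add: field_simps)
qed

text \<open>Jordan's bound is applied at whichever of the zeros 0 and \<open>pi\<close> is nearer.
  Adding both reciprocals avoids a case split later and sums to harmonic numbers over a
  grid.\<close>

lemma inverse_sin_le:
  fixes x :: real
  assumes "0 < x" "x < pi"
  shows "1 / sin x \<le> pi / 2 * (1 / x + 1 / (pi - x))"
proof -
  have *: "1 / sin y \<le> pi / 2 * (1 / y)" if "0 < y" "y \<le> pi / 2" for y :: real
  proof -
    have "1 / sin y \<le> 1 / (2 / pi * y)"
      using that sin_ge_jordan[of y] by (intro divide_left_mono mult_pos_pos sin_gt_zero) auto
    then show ?thesis by simp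
  qed
  show ?thesis
  proof (cases "x \<le> pi / 2")
    case True
    have "pi / 2 * (1 / x) \<le> pi / 2 * (1 / x + 1 / (pi - x))"
      using assms by (intro mult_left_mono) auto
    with *[of x] True assms show ?thesis by linarith
  next
    case False
    have "pi / 2 * (1 / (pi - x)) \<le> pi / 2 * (1 / x + 1 / (pi - x))"
      using assms by (intro mult_left_mono) auto
    moreover have "1 / sin x \<le> pi / 2 * (1 / (pi - x))"
      using *[of "pi - x"] False assms by (simp only: sin_pi_minus)
    ultimately show ?thesis by linarith
  qed
qed

lemma abs_sin_diff_le: "\<bar>sin x - sin y\<bar> \<le> \<bar>x - y\<bar>" for x y :: real
proof -
  have "\<bar>sin x - sin y\<bar> = 2 * \<bar>sin ((x - y) / 2)\<bar> * \<bar>cos ((x + y) / 2)\<bar>"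
    by (simp add: sin_diff_sin abs_mult)
  also have "\<dots> \<le> 2 * \<bar>(x - y) / 2\<bar> * 1"
    by (intro mult_mono abs_sin_x_le_abs_x) auto
  finally show ?thesis by simp
qed

text \<open>The sequence \<open>harm n - ln n\<close> decreases from its value 1 at
  \<open>n = 1\<close>.\<close>

lemma harm_le_ln: "n > 0 \<Longrightarrow> harm n \<le> 1 + ln (real n)"
  using euler_mascheroni_sequence_decreasing[of 1 n] by (simp add: harm_def)

section \<open>Sine products through roots of unity\<close>

text \<open>As polynomials in \<open>z\<close>, both sides are monic of degree \<open>q - 1\<close>
  and vanish at the \<open>q - 1\<close> nontrivial roots of unity, hence coincide.\<close>

lemma prod_diff_roots_unity:
  fixes z :: complex
  assumes "q > 0"
  shows "(\<Prod>j\<in>{1..<q}. z - cis (2 * pi * real j / real q)) = (\<Sum>i<q. z ^ i)"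
proof -
  let ?w = "\<lambda>j. cis (2 * pi * real j / real q)"
  define P where "P = (\<Prod>j\<in>{1..<q}. [:- ?w j, 1:])"
  define S where "S = (\<Sum>i<q. monom (1::complex) i)"
  have bij: "bij_betw ?w {..<q} {z. z ^ q = 1}"
    using assms by (rule Complex.bij_betw_roots_unity)
  have inj: "inj_on ?w {1..<q}"
    using bij by (auto simp: bij_betw_def intro: inj_on_subset)
  have degP: "degree P = q - 1"
    unfolding P_def by (subst degree_prod_eq_sum_degree) auto
  have "lead_coeff P = 1"
    unfolding P_def by (subst lead_coeff_prod) simp
  then have coeffP: "coeff P (q - 1) = 1"
    by (simp add: degP)
  have coeffS: "coeff S n = (if n < q then 1 else 0)" for n
    by (simp add: S_def coeff_sum)
  have "P = S"
  proof (rule poly_eqI_degree_lead_coeff[where n = "q - 1" and A = "?w ` {1..<q}"])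
    show "coeff P (q - 1) = coeff S (q - 1)"
      using assms coeffP coeffS[of "q - 1"] by simp
    show "q - 1 \<le> card (?w ` {1..<q})"
      by (subst card_image[OF inj]) simp
    show "degree P \<le> q - 1"
      by (simp add: degP)
    show "degree S \<le> q - 1"
      by (rule degree_le) (auto simp: coeffS)
    fix x assume "x \<in> ?w ` {1..<q}"
    then obtain j where j: "j \<in> {1..<q}" "x = ?w j" by blast
    have "x ^ q = 1"
      using j bij_betwE[OF bij] by simp
    moreover have "x \<noteq> 1"
    proof
      assume "x = 1"
      then have "?w j = ?w 0" using j by simp
      then have "j = 0"
        using j inj_onD[OF bij_betw_imp_inj_on[OF bij], of j 0] by simp
      with j show False by simp
    qed
    ultimately have "poly S x = 0"
      by (simp add: S_def poly_sum poly_monom geometric_sum)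
    moreover have "poly P x = 0"
      using j by (auto simp: P_def poly_prod)
    ultimately show "poly P x = poly S x" by simp
  qed
  then have "poly P z = poly S z" by simp
  then show ?thesis by (simp add: P_def S_def poly_prod poly_sum poly_monom)
qed

text \<open>This is the length of a chord of the unit circle. The summands are separated so that
  \<open>y = pi * j / q\<close> runs through roots of unity while \<open>x\<close> fixes the other
  endpoint.\<close>

lemma abs_2_sin_eq_norm: "\<bar>2 * sin (x + y)\<bar> = norm (cis (- 2 * x) - cis (2 * y))"
proof -
  have "norm (cis (- 2 * x) - cis (2 * y)) = norm (cis (- 2 * x) * (1 - cis (2 * (x + y))))"
    by (simp add: algebra_simps cis_mult)
  also have "\<dots> = norm (exp (\<i> * of_real (2 * (x + y))) - 1)"
    by (simp add: norm_mult norm_minus_commute cis_conv_exp)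
  also have "\<dots> = \<bar>2 * sin (x + y)\<bar>"
    by (simp only: dist_exp_i_1 abs_mult) (simp del: distrib_left_numeral)
  finally show ?thesis by simp
qed

lemma prod_abs_2_sin_eq_norm:
  assumes "q > 0"
  shows "(\<Prod>j\<in>{1..<q}. \<bar>2 * sin (x + pi * real j / real q)\<bar>) = norm (\<Sum>i<q. cis (- 2 * x) ^ i)"
  by (subst prod_diff_roots_unity[OF assms, symmetric])
     (simp add: abs_2_sin_eq_norm prod_norm mult.assoc)

lemma prod_abs_2_sin_le:
  assumes "q > 0"
  shows "(\<Prod>j\<in>{1..<q}. \<bar>2 * sin (x + pi * real j / real q)\<bar>) \<le> real q"
proof -
  have "norm (\<Sum>i<q. cis (- 2 * x) ^ i) \<le> (\<Sum>i<q. 1)"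
    by (rule sum_norm_le) (simp add: norm_power)
  then show ?thesis unfolding prod_abs_2_sin_eq_norm[OF assms] by simp
qed

text \<open>The factor \<open>\<bar>2 * sin x\<bar>\<close> supplies the missing root 1, so the
  geometric sum closes up to \<open>z ^ q - 1\<close>.\<close>

lemma abs_2_sin_mult_prod_le:
  assumes "q > 0"
  shows "\<bar>2 * sin x\<bar> * (\<Prod>j\<in>{1..<q}. \<bar>2 * sin (x + pi * real j / real q)\<bar>) \<le> 2"
proof -
  let ?z = "cis (- 2 * x)"
  have "\<bar>2 * sin x\<bar> * (\<Prod>j\<in>{1..<q}. \<bar>2 * sin (x + pi * real j / real q)\<bar>) =
      norm (?z - 1) * norm (\<Sum>i<q. ?z ^ i)"
    unfolding prod_abs_2_sin_eq_norm[OF assms] using abs_2_sin_eq_norm[of x 0] by simp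
  also have "\<dots> = norm (?z ^ q - 1)"
    by (simp only: norm_mult [symmetric] power_diff_1_eq)
  also have "\<dots> \<le> norm (?z ^ q) + norm (1 :: complex)"
    by (rule norm_triangle_ineq4)
  finally show ?thesis by (simp add: norm_power)
qed

section \<open>Perturbed products over equally spaced points\<close>

lemma sum_inverse_add_eq_harm:
  "(\<Sum>j\<in>{1..<q}. 1 / real j + 1 / real (q - j)) = 2 * harm (q - 1)"
proof -
  have "(\<Sum>j\<in>{1..<q}. 1 / real (q - j)) = (\<Sum>j\<in>{1..<q}. 1 / real j)"
    by (rule sum.reindex_bij_witness[of _ "\<lambda>j. q - j" "\<lambda>j. q - j"]) auto
  moreover have "(\<Sum>j\<in>{1..<q}. 1 / real j) = harm (q - 1)"
    unfolding harm_def by (rule sum.cong) (auto simp: inverse_eq_divide)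
  ultimately show ?thesis by (simp add: sum.distrib)
qed

text \<open>A shift of at most half the grid spacing leaves only \<open>j = 0\<close> possibly near
  a zero of the sine. Every other factor absorbs the error \<open>d\<close> through
  \<open>1 + u \<le> exp u\<close>, and the exponents sum to a harmonic number.\<close>

lemma prod_abs_2_sin_add_le_small_shift:
  assumes q: "q > 0" and x: "\<bar>x\<bar> \<le> pi / (2 * real q)" and d: "d \<ge> 0"
  shows "(\<Prod>j<q. \<bar>2 * sin (x + pi * real j / real q)\<bar> + d)
           \<le> (2 + real q * d) * exp (d * real q * harm q)"
proof -
  let ?a = "\<lambda>j. \<bar>2 * sin (x + pi * real j / real q)\<bar>"
  have a: "0 < ?a j \<and> 1 / ?a j \<le> real q / 2 * (1 / real j + 1 / real (q - j))" if j: "j \<in> {1..<q}" for j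
  proof -
    define y where "y = x + pi * real j / real q"
    have "real j \<ge> 1" "real (q - j) \<ge> 1" using j by auto
    \<comment> \<open>The shift uses up at most half the distance from the grid point to 0 and to
      \<open>pi\<close>.\<close>
    then have "pi / (2 * real q) \<le> pi * real j / (2 * real q)"
       "pi / (2 * real q) \<le> pi * real (q - j) / (2 * real q)"
      using q by (auto intro!: divide_right_mono)
    moreover have "pi - pi * real j / real q = pi * real (q - j) / real q"
      using j q by (simp add: field_simps of_nat_diff)
    ultimately have y: "pi * real j / (2 * real q) \<le> y" "pi * real (q - j) / (2 * real q) \<le> pi - y"
      using x unfolding y_def by (auto simp: abs_le_iff)
    have pos: "0 < pi * real j / (2 * real q)" "0 < pi * real (q - j) / (2 * real q)"
      using j q by auto
    have s: "sin y > 0" using y pos by (intro sin_gt_zero) linarith+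
    have "1 / sin y \<le> pi / 2 * (1 / y + 1 / (pi - y))"
      using y pos by (intro inverse_sin_le) linarith+
    also have "\<dots> \<le> pi / 2 * (1 / (pi * real j / (2 * real q)) + 1 / (pi * real (q - j) / (2 * real q)))"
      using y pos by (intro mult_left_mono add_mono divide_left_mono mult_pos_pos) (linarith | simp)+
    also have "\<dots> = real q * (1 / real j + 1 / real (q - j))"
      by (simp add: distrib_left)
    finally have "1 / sin y / 2 \<le> real q / 2 * (1 / real j + 1 / real (q - j))"
      by simp
    then show ?thesis using s unfolding y_def[symmetric] by (simp add: abs_mult)
  qed
  let ?P = "\<Prod>j\<in>{1..<q}. ?a j"
  \<comment> \<open>The factor \<open>j = 0\<close> may vanish, so it is kept out of the relative estimate.\<close>
  have "(\<Prod>j\<in>{1..<q}. ?a j + d) \<le> (\<Prod>j\<in>{1..<q}. ?a j * exp (d * (1 / ?a j)))"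
  proof (rule prod_mono, safe)
    fix j assume j: "j \<in> {1..<q}"
    have "?a j + d = ?a j * (1 + d * (1 / ?a j))"
      using a[OF j] by (simp add: field_simps)
    also have "\<dots> \<le> ?a j * exp (d * (1 / ?a j))"
      by (intro mult_left_mono exp_ge_add_one_self) auto
    finally show "?a j + d \<le> ?a j * exp (d * (1 / ?a j))" .
  qed (use d in simp)
  also have "\<dots> = ?P * exp (\<Sum>j\<in>{1..<q}. d * (1 / ?a j))"
    by (simp add: prod.distrib exp_sum)
  also have "\<dots> \<le> ?P * exp (d * real q * harm q)"
  proof -
    have "(\<Sum>j\<in>{1..<q}. d * (1 / ?a j)) \<le>
        (\<Sum>j\<in>{1..<q}. d * (real q / 2 * (1 / real j + 1 / real (q - j))))"
      using a d by (intro sum_mono mult_left_mono) auto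
    also have "\<dots> = d * real q * harm (q - 1)"
      by (simp only: sum_distrib_left [symmetric] sum_inverse_add_eq_harm)
    also have "\<dots> \<le> d * real q * harm q"
      using d by (intro mult_left_mono harm_mono) auto
    finally show ?thesis by (intro mult_left_mono prod_nonneg) auto
  qed
  finally have le: "(\<Prod>j\<in>{1..<q}. ?a j + d) \<le> ?P * exp (d * real q * harm q)" .
  have "(\<Prod>j<q. ?a j + d) = (?a 0 + d) * (\<Prod>j\<in>{1..<q}. ?a j + d)"
    using q by (simp add: lessThan_atLeast0 prod.atLeast_Suc_lessThan)
  also have "\<dots> \<le> (?a 0 + d) * (?P * exp (d * real q * harm q))"
    using le d by (intro mult_left_mono) auto
  \<comment> \<open>The first summand is the full product, at most 2; in the second, the product
    without \<open>j = 0\<close> is at most \<open>q\<close>.\<close>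
  also have "\<dots> = (?a 0 * ?P + ?P * d) * exp (d * real q * harm q)"
    by (simp add: algebra_simps)
  also have "\<dots> \<le> (2 + real q * d) * exp (d * real q * harm q)"
    using abs_2_sin_mult_prod_le[OF q, of x] prod_abs_2_sin_le[OF q, of x] d
    by (intro mult_right_mono add_mono) auto
  finally show ?thesis .
qed

section \<open>From the uniform grid to multiples of a reduced fraction\<close>

text \<open>Multiplication by \<open>p\<close> is injective modulo \<open>q\<close>, and adding
  \<open>k\<close> only translates the residues.\<close>

lemma bij_betw_affine_mod:
  fixes p k :: int
  assumes q: "q > 0" and cop: "coprime p (int q)"
  shows "bij_betw (\<lambda>n. nat ((int n * p + k) mod int q)) {1..q} {..<q}"
proof -
  let ?f = "\<lambda>n. nat ((int n * p + k) mod int q)"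
  have "inj_on ?f {1..q}"
  proof (rule inj_onI)
    fix m n assume mn: "m \<in> {1..q}" "n \<in> {1..q}" "?f m = ?f n"
    then have "(int m * p + k) mod int q = (int n * p + k) mod int q"
      using q by (simp add: eq_nat_nat_iff)
    then have "int q dvd (int m * p + k) - (int n * p + k)"
      by (simp add: mod_eq_dvd_iff)
    then have "int q dvd (int m - int n) * p"
      by (simp add: algebra_simps)
    then have "int q dvd int m - int n"
      using cop by (simp add: coprime_dvd_mult_left_iff coprime_commute)
    moreover have "\<bar>int m - int n\<bar> < int q"
      using mn by auto
    ultimately show "m = n"
      by (metis dvd_imp_le_int eq_iff_diff_eq_0 linorder_not_less of_nat_eq_iff abs_of_nat)
  qed
  moreover have "?f ` {1..q} = {..<q}"
  proof (rule card_subset_eq)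
    show "?f ` {1..q} \<subseteq> {..<q}" using q by (auto simp: nat_less_iff)
    show "card (?f ` {1..q}) = card {..<q}"
      using \<open>inj_on ?f {1..q}\<close> by (simp add: card_image)
  qed auto
  ultimately show ?thesis by (simp add: bij_betw_def)
qed

lemma abs_sin_add_int_pi: "\<bar>sin (x + pi * of_int m)\<bar> = \<bar>sin x\<bar>"
proof -
  have "sin (pi * of_int m) = 0" by (simp add: sin_zero_iff_int2)
  moreover from this have "\<bar>cos (pi * of_int m)\<bar> = 1"
    using sin_cos_squared_add[of "pi * of_int m"] by (simp add: power2_eq_1_iff abs_if)
  ultimately show ?thesis by (simp add: sin_add abs_mult)
qed

lemma prod_abs_2_sin_add_le:
  fixes p :: int
  assumes q: "q > 0" and cop: "coprime p (int q)" and d: "d \<ge> 0"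
  shows "(\<Prod>n=1..q. \<bar>2 * sin (x + pi * (real n * of_int p / real q))\<bar> + d)
           \<le> (2 + real q * d) * exp (d * real q * harm q)"
proof -
  \<comment> \<open>Removing the nearest multiple of \<open>pi / q\<close> makes the shift small.
    The removed multiple becomes the translation \<open>k\<close> of residues, and whole multiples
    of \<open>pi\<close> do not change the absolute sine.\<close>
  define k where "k = round (x * real q / pi)"
  define y where "y = x - pi * of_int k / real q"
  have "\<bar>x * real q / pi - of_int k\<bar> \<le> 1 / 2"
    unfolding k_def using of_int_round_abs_le by (simp add: abs_minus_commute)
  then have "\<bar>y\<bar> \<le> pi / (2 * real q)"
    unfolding y_def using q by (simp add: field_simps)
  from prod_abs_2_sin_add_le_small_shift[OF q this d]
  have "(\<Prod>j<q. \<bar>2 * sin (y + pi * real j / real q)\<bar> + d)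
           \<le> (2 + real q * d) * exp (d * real q * harm q)" .
  also have "(\<Prod>j<q. \<bar>2 * sin (y + pi * real j / real q)\<bar> + d) =
     (\<Prod>n=1..q. \<bar>2 * sin (y + pi * real (nat ((int n * p + k) mod int q)) / real q)\<bar> + d)"
    by (rule prod.reindex_bij_betw[OF bij_betw_affine_mod[OF q cop], symmetric])
  also have "\<dots> = (\<Prod>n=1..q. \<bar>2 * sin (x + pi * (real n * of_int p / real q))\<bar> + d)"
  proof (rule prod.cong, simp)
    fix n assume "n \<in> {1..q}"
    let ?m = "int n * p + k"
    have "real_of_int ?m = of_int (?m div int q * int q + ?m mod int q)"
      by (simp only: div_mult_mod_eq)
    then have *: "real n * of_int p + of_int k = of_int (?m div int q) * real q + of_int (?m mod int q)"
      by (simp only: of_int_add of_int_mult of_int_of_nat_eq)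
    have "x + pi * (real n * of_int p / real q) =
        y + pi * real (nat (?m mod int q)) / real q + pi * of_int (?m div int q)"
      (is "?l = ?r")
    proof -
      have "?l = y + pi * ((real n * of_int p + of_int k) / real q)"
        unfolding y_def by (simp add: add_divide_distrib distrib_left)
      also have "\<dots> = y + pi * (of_int (?m div int q) + of_int (?m mod int q) / real q)"
        unfolding * using q by (simp add: add_divide_distrib)
      also have "\<dots> = ?r"
        using q by (simp add: distrib_left)
      finally show ?thesis .
    qed
    then show "\<bar>2 * sin (y + pi * real (nat (?m mod int q)) / real q)\<bar> + d =
       \<bar>2 * sin (x + pi * (real n * of_int p / real q))\<bar> + d"
      by (simp add: abs_mult abs_sin_add_int_pi)
  qed
  finally show ?thesis .
qed

section \<open>Blocks of length \<open>q\<close> for the irrational rotation\<close>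

text \<open>For \<open>n \<le> q\<close>, replacing \<open>\<alpha>\<close> by \<open>p / q\<close>
  moves the argument by at most \<open>pi / N\<close>. As the sine is 1-Lipschitz, each factor
  changes by at most \<open>d = 2 * pi / N\<close>.\<close>

lemma prod_abs_2_sin_block_le:
  fixes p :: int and \<alpha> :: real
  assumes q: "q > 0" "q \<le> N" and cop: "coprime p (int q)"
    and approx: "\<bar>real q * \<alpha> - of_int p\<bar> \<le> 1 / real N"
  shows "(\<Prod>n=1..q. \<bar>2 * sin (x + pi * (real n * \<alpha>))\<bar>)
           \<le> (2 + 2 * pi) * exp (2 * pi * real q / real N * (1 + ln (real N)))"
proof -
  define d where "d = 2 * pi / real N"
  have d: "d \<ge> 0" by (simp add: d_def)
  have "(\<Prod>n=1..q. \<bar>2 * sin (x + pi * (real n * \<alpha>))\<bar>)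
      \<le> (\<Prod>n=1..q. \<bar>2 * sin (x + pi * (real n * of_int p / real q))\<bar> + d)"
  proof (rule prod_mono, safe)
    fix n assume n: "n \<in> {1..q}"
    let ?u = "x + pi * (real n * \<alpha>)" and ?v = "x + pi * (real n * of_int p / real q)"
    have "?u - ?v = pi * (real n / real q) * (real q * \<alpha> - of_int p)"
      using q by (simp add: field_simps)
    then have "\<bar>?u - ?v\<bar> = pi * (real n / real q) * \<bar>real q * \<alpha> - of_int p\<bar>"
      by (simp add: abs_mult)
    also have "\<dots> \<le> pi * 1 * (1 / real N)"
      using n q approx by (intro mult_mono) auto
    finally have "\<bar>sin ?u - sin ?v\<bar> \<le> pi / real N"
      using abs_sin_diff_le[of ?u ?v] by simp
    then show "\<bar>2 * sin ?u\<bar> \<le> \<bar>2 * sin ?v\<bar> + d"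
      by (simp add: d_def abs_mult)
  qed auto
  also have "\<dots> \<le> (2 + real q * d) * exp (d * real q * harm q)"
    using q cop d by (intro prod_abs_2_sin_add_le)
  also have "\<dots> \<le> (2 + 2 * pi) * exp (d * real q * (1 + ln (real N)))"
  proof (intro mult_mono)
    show "2 + real q * d \<le> 2 + 2 * pi"
      unfolding d_def using q by (simp add: field_simps)
    have "harm q \<le> 1 + ln (real N)"
      using harm_le_ln[of N] harm_mono[of q N, where 'a = real] q by linarith
    then show "exp (d * real q * harm q) \<le> exp (d * real q * (1 + ln (real N)))"
      using d by (simp add: mult_left_mono)
  qed auto
  finally show ?thesis by (simp add: d_def)
qed

text \<open>The second piece is a product of the same shape with a new shift, so bounds uniform in
  \<open>x\<close> can be iterated.\<close>

lemma prod_shift_add: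
  fixes f :: "real \<Rightarrow> 'a :: comm_monoid_mult" and \<alpha> :: real
  shows "(\<Prod>n=1..a+b. f (x + pi * (real n * \<alpha>))) =
    (\<Prod>n=1..a. f (x + pi * (real n * \<alpha>))) * (\<Prod>n=1..b. f ((x + pi * (real a * \<alpha>)) + pi * (real n * \<alpha>)))"
  by (induction b) (simp_all add: algebra_simps)

lemma prod_blocks_le:
  fixes f :: "real \<Rightarrow> real" and \<alpha> :: real
  assumes "\<And>x. f x \<ge> 0" and "\<And>x. (\<Prod>n=1..q. f (x + pi * (real n * \<alpha>))) \<le> B"
  shows "(\<Prod>n=1..M * q. f (x + pi * (real n * \<alpha>))) \<le> B ^ M"
proof (induction M arbitrary: x)
  case (Suc M)
  have "B \<ge> 0"
    using assms(2)[of 0] prod_nonneg[of "{1..q}" "\<lambda>n. f (0 + pi * (real n * \<alpha>))"] assms(1)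
    by (meson order_trans)
  then have "(\<Prod>n=1..q + M * q. f (x + pi * (real n * \<alpha>))) \<le> B * B ^ M"
    unfolding prod_shift_add using assms Suc by (intro mult_mono prod_nonneg) auto
  then show ?case by simp
qed simp

section \<open>The type condition and the induction on \<open>N\<close>\<close>

text \<open>Multiplying the type inequality by \<open>q\<close> gives
  \<open>c / q powr t < 1 / N\<close>; solve for \<open>q\<close>.\<close>

lemma of_type_approx_denominator_ge:
  fixes p :: int
  assumes c: "\<And>p q :: int. q \<ge> 1 \<Longrightarrow> gcd p q = 1 \<Longrightarrow>
      \<bar>\<alpha> - real_of_int p / real_of_int q\<bar> > c * (1 / real_of_int q powr (1 + t))"
    and "c > 0" "t > 0" and q: "q > 0" "N > 0" and cop: "coprime p (int q)"
    and approx: "\<bar>real q * \<alpha> - of_int p\<bar> < 1 / real N"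
  shows "(c * real N) powr (1 / t) \<le> real q"
proof -
  have "c / real q powr t = real q * (c * (1 / real q powr (1 + t)))"
    using q by (simp add: powr_add)
  also have "\<dots> \<le> real q * \<bar>\<alpha> - of_int p / real q\<bar>"
    using c[of "int q" p] q cop by (intro mult_left_mono) (auto simp: coprime_iff_gcd_eq_1)
  also have "\<dots> = \<bar>real q * (\<alpha> - of_int p / real q)\<bar>"
    by (simp add: abs_mult)
  also have "\<dots> = \<bar>real q * \<alpha> - of_int p\<bar>"
    using q by (simp add: right_diff_distrib)
  also note approx
  finally have "c * real N < real q powr t"
    using q by (simp add: field_simps)
  then have "(c * real N) powr (1 / t) \<le> (real q powr t) powr (1 / t)"
    using assms(2,3) q by (intro powr_mono2) auto
  then show ?thesis using assms(3) q by (simp add: powr_powr)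
qed

theorem corollary2:
  fixes \<alpha> t :: real
  assumes "of_type \<alpha> t" and "t > 1"
  shows "\<exists>C :: real. \<forall>\<^sub>F N :: nat in sequentially.
           (\<Prod>n=1..N. \<bar>2 * sin (pi * real n * \<alpha>)\<bar>) \<le> 2 powr (C * real N powr (1 - 1 / t))"
proof -
  obtain c where c: "c > 0" and type: "\<And>p q :: int. q \<ge> 1 \<Longrightarrow> gcd p q = 1 \<Longrightarrow>
      \<bar>\<alpha> - real_of_int p / real_of_int q\<bar> > c * (1 / real_of_int q powr (1 + t))"
    using assms(1) unfolding of_type_def by blast
  define b where "b = 1 - 1 / t"
  have b: "b > 0" using assms(2) by (simp add: b_def)
  define L where "L = ln (2 + 2 * pi) * c powr (- 1 / t) + 2 * pi * (1 + 1 / b)"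
  define K where "K = L / (1 - 2 powr (- b))"
  have ln_pos: "ln (2 + 2 * pi) > 0"
    using pi_gt_zero by (intro ln_gt_zero) linarith
  then have L: "L \<ge> 0"
    using b unfolding L_def by (intro add_nonneg_nonneg mult_nonneg_nonneg) auto
  have two: "2 powr (- b) < (1 :: real)"
    using b powr_less_mono[of "- b" 0 "2 :: real"] by simp
  \<comment> \<open>\<open>L\<close> is the cost of one Dirichlet step; \<open>K\<close> sums the geometric series over the steps.\<close>
  from two have K: "K \<ge> 0" and LK: "L + K * 2 powr (- b) = K"
    using L b by (simp_all add: K_def divide_simps) (simp add: algebra_simps)
  have main: "(\<Prod>n=1..N. \<bar>2 * sin (x + pi * (real n * \<alpha>))\<bar>) \<le> exp (K * real N powr b)" for N x
  proof (induction N arbitrary: x rule: less_induct)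
    case (less N)
    show ?case
    proof (cases "N = 0")
      case False
      then have N: "N > 0" by simp
      obtain p k :: int where "coprime p k" "0 < k" "k \<le> int N"
          "\<bar>of_int k * \<alpha> - of_int p\<bar> < 1 / real N"
        using Dirichlet_approx_coprime[OF N] by metis
      then obtain q where q: "q > 0" "q \<le> N" "coprime p (int q)"
          "\<bar>real q * \<alpha> - of_int p\<bar> < 1 / real N"
        by (metis of_int_of_nat_eq of_nat_0_less_iff of_nat_le_iff zero_less_imp_eq_int)
      have qge: "(c * real N) powr (1 / t) \<le> real q"
        using type c assms(2) q N by (intro of_type_approx_denominator_ge[where p = p and \<alpha> = \<alpha>]) auto
      define M r where "M = N div q" and "r = N mod q"
      have N_eq: "N = M * q + r" by (simp add: M_def r_def)
      have "M \<ge> 1" "r < q" using q by (auto simp: M_def r_def Suc_le_eq div_greater_zero_iff)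
      \<comment> \<open>Both follow from \<open>r < q \<le> M * q\<close>.\<close>
      then have "r < N" "2 * r \<le> N"
        using q N_eq mult_le_mono1[of 1 M q] by linarith+
      let ?E = "2 * pi * real q / real N * (1 + ln (real N))"
      have Mq: "real M * real q \<le> real N"
        by (subst N_eq) simp
      have "(\<Prod>n=1..M * q. \<bar>2 * sin (x + pi * (real n * \<alpha>))\<bar>) \<le> ((2 + 2 * pi) * exp ?E) ^ M"
        using q by (intro prod_blocks_le prod_abs_2_sin_block_le) auto
      also have "\<dots> = exp (real M * ln (2 + 2 * pi) + real M * ?E)"
        using pi_gt_zero
      by (simp only: exp_add exp_of_nat_mult power_mult_distrib exp_ln add_pos_pos mult_pos_pos zero_less_numeral)
      also have "\<dots> \<le> exp (L * real N powr b)"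
      proof -
        have pos: "(c * real N) powr (1 / t) > 0"
          using c N by simp
        \<comment> \<open>The lower bound on \<open>q\<close> limits the number of blocks, which
          yields the first summand of \<open>L\<close>.\<close>
        have "real M \<le> real N / real q"
          using Mq q by (simp add: field_simps)
        also have "\<dots> \<le> real N / (c * real N) powr (1 / t)"
          using qge pos q by (intro divide_left_mono) auto
        also have "\<dots> = c powr (- 1 / t) * real N powr b"
          using c N by (simp add: powr_mult b_def powr_diff powr_minus_divide)
        finally have 1: "real M * ln (2 + 2 * pi) \<le> c powr (- 1 / t) * real N powr b * ln (2 + 2 * pi)"
          using ln_pos by (intro mult_right_mono) auto
        \<comment> \<open>The block count cancels against \<open>q / N\<close>, leaving a single
          logarithm. It is absorbed by \<open>ln N \<le> N powr b / b\<close>, giving the second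
          summand of \<open>L\<close>.\<close>
        have "real M * ?E = 2 * pi * (1 + ln (real N)) * (real M * real q / real N)"
          by simp
        also have "\<dots> \<le> 2 * pi * (1 + ln (real N)) * 1"
          using Mq N by (intro mult_left_mono) auto
        also have "\<dots> \<le> 2 * pi * (real N powr b + real N powr b / b) * 1"
          using N b by (intro mult_left_mono mult_right_mono add_mono ln_powr_bound ge_one_powr_ge_zero) auto
        finally show ?thesis using 1 unfolding L_def exp_le_cancel_iff by (simp add: algebra_simps)
      qed
      finally have blocks: "(\<Prod>n=1..M * q. \<bar>2 * sin (x + pi * (real n * \<alpha>))\<bar>) \<le> exp (L * real N powr b)" .
      have "real r powr b \<le> (real N / 2) powr b"
        using \<open>2 * r \<le> N\<close> b by (intro powr_mono2) auto
      also have "\<dots> = 2 powr (- b) * real N powr b"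
        by (simp add: powr_divide powr_minus_divide)
      finally have r: "K * real r powr b \<le> K * (2 powr (- b) * real N powr b)"
        using K by (rule mult_left_mono)
      have "(\<Prod>n=1..N. \<bar>2 * sin (x + pi * (real n * \<alpha>))\<bar>) \<le> exp (L * real N powr b) * exp (K * real r powr b)"
        unfolding prod_shift_add[of "\<lambda>y. \<bar>2 * sin y\<bar>" x \<alpha> "M * q" r, folded N_eq]
        using blocks less.IH[OF \<open>r < N\<close>] by (intro mult_mono prod_nonneg) auto
      also have "\<dots> = exp (L * real N powr b + K * real r powr b)"
        by (simp add: exp_add)
      also have "\<dots> \<le> exp (L * real N powr b + K * (2 powr (- b) * real N powr b))"
        using r by simp
      also have "L * real N powr b + K * (2 powr (- b) * real N powr b) = (L + K * 2 powr (- b)) * real N powr b"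
        by (simp add: algebra_simps)
      finally show ?thesis by (simp only: LK)
    qed simp
  qed
  \<comment> \<open>Division by \<open>ln 2\<close> changes the base from e to 2.\<close>
  have "(\<Prod>n=1..N. \<bar>2 * sin (pi * real n * \<alpha>)\<bar>) \<le> 2 powr (K / ln 2 * real N powr (1 - 1 / t))" for N
    using main[where x = 0 and N = N] by (simp add: powr_def b_def mult.assoc)
  then show ?thesis by (intro exI[of _ "K / ln 2"]) simp
qed

end
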